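(* Let $X$ be a metric space, $\varphi_1,\varphi_2\colon X\to\mathbb{R}_\infty$ and $\bar x\in\operatorname{dom}\varphi_1\cap\operatorname{dom}\varphi_2$. (i) If $\bar x$ is a local quasiuniform minimum of $\varphi_1+\varphi_2$, then it is a local minimum of $\varphi_1+\varphi_2$. The two properties are equivalent provided that $(\varphi_1,\varphi_2)$ is quasiuniformly lower semicontinuous near $\bar x$. (ii) Let $\varepsilon>0$ and $\delta>0$. If $\bar x$ is a quasiuniform $\varepsilon$-minimum of $\varphi_1+\varphi_2$ on $B_\delta(\bar x)$, then it is an $\varepsilon$-minimum of $\varphi_1+\varphi_2$ on $B_\delta(\bar x)$. The two properties are equivalent provided that $(\varphi_1,\varphi_2)$ is quasiuniformly lower semicontinuous on $B_\delta(\bar x)$. (iii) If $\bar x$ is a quasiuniform stationary point of $\varphi_1+\varphi_2$, then $\bar x$ is stationary for $\varphi_1+\varphi_2$. The two properties are equivalent provided that $(\varphi_1,\varphi_2)$ is quasiuniformly lower semicontinuous near $\bar x$.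
   Context: $\mathbb{R}_\infty:=\mathbb{R}\cup\{+\infty\}$, $\operatorname{dom}\varphi:=\{x\mid\varphi(x)<+\infty\}$; $B_\delta(x)$, $\overline B_\delta(x)$ are the open and closed balls; $\inf\emptyset=+\infty$. A set $V\subset X$ is an essentially interior subset of $U\subset X$ if $\bigcup_{x\in V}B_\rho(x)\subset U$ for some $\rho>0$; $EI(U)$ is the collection of all such $V$ (including $\emptyset$). Put $$\Lambda_U^\circ(\varphi_1,\varphi_2):=\lim_{\eta\downarrow0}\ \inf_{x_1,x_2\in U,\ d(x_1,x_2)<\eta}(\varphi_1(x_1)+\varphi_2(x_2)),\qquad \Lambda_U^\dagger(\varphi_1,\varphi_2):=\inf_{V\in EI(U)}\Lambda_V^\circ(\varphi_1,\varphi_2).$$ Definitions. The pair $(\varphi_1,\varphi_2)$ is quasiuniformly lower semicontinuous on $U$ if $\inf_U(\varphi_1+\varphi_2)\le\Lambda_U^\dagger(\varphi_1,\varphi_2)$; it is quasiuniformly lower semicontinuous near $\bar x$ if it is so on $\overline B_\delta(\bar x)$ for all sufficiently small $\delta>0$. The point $\bar x$ is: - a local quasiuniform minimum of $\varphi_1+\varphi_2$ if $(\varphi_1+\varphi_2)(\bar x)=\Lambda_{B_\delta(\bar x)}^\dagger(\varphi_1,\varphi_2)$ for some $\delta>0$; - a quasiuniform $\varepsilon$-minimum of $\varphi_1+\varphi_2$ on $B_\delta(\bar x)$ if $(\varphi_1+\varphi_2)(\bar x)<\Lambda_{B_\delta(\bar x)}^\dagger(\varphi_1,\varphi_2)+\varepsilon$;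 - a quasiuniform stationary point of $\varphi_1+\varphi_2$ if for any $\varepsilon>0$ there is $\delta_\varepsilon>0$ such that, for any $\delta\in(0,\delta_\varepsilon)$, $\bar x$ is a quasiuniform $\varepsilon\delta$-minimum of $\varphi_1+\varphi_2$ on $B_\delta(\bar x)$. For $f\colon X\to\mathbb{R}_\infty$ and $\bar x\in\operatorname{dom}f$: $\bar x$ is an $\varepsilon$-minimum of $f$ on $U\ni\bar x$ if $\inf_Uf>f(\bar x)-\varepsilon$; $\bar x$ is stationary for $f$ if $\liminf_{x\to\bar x,\,x\ne\bar x}\frac{f(x)-f(\bar x)}{d(x,\bar x)}\ge0$. *)

theory Defs
  imports "HOL-Analysis.Analysis"
begin

text \<open>
  Functions with values in the reals extended by $+\infty$ are rendered as
  \<^typ>\<open>ereal\<close>-valued functions that never take the value $-\infty$. In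
  \<^typ>\<open>ereal\<close> the infimum of the empty set is $+\infty$.
\<close>

definition Rinf_valued :: "('a \<Rightarrow> ereal) \<Rightarrow> bool" where
  "Rinf_valued f \<longleftrightarrow> (\<forall>x. f x \<noteq> - \<infinity>)"

definition edom :: "('a \<Rightarrow> ereal) \<Rightarrow> 'a set" where
  "edom f = {x. f x < \<infinity>}"

definition EI :: "'a::metric_space set \<Rightarrow> 'a set set" where
  "EI U = {V. V \<subseteq> U \<and> (\<exists>\<rho>>0. (\<Union>x\<in>V. ball x \<rho>) \<subseteq> U)}"

definition inf_near_diag ::
  "'a::metric_space set \<Rightarrow> ('a \<Rightarrow> ereal) \<Rightarrow> ('a \<Rightarrow> ereal) \<Rightarrow> real \<Rightarrow> ereal" where
  "inf_near_diag U \<phi>1 \<phi>2 \<eta> =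
     (INF (x1, x2) \<in> {(x1, x2). x1 \<in> U \<and> x2 \<in> U \<and> dist x1 x2 < \<eta>}. \<phi>1 x1 + \<phi>2 x2)"

definition Lambda_circ ::
  "'a::metric_space set \<Rightarrow> ('a \<Rightarrow> ereal) \<Rightarrow> ('a \<Rightarrow> ereal) \<Rightarrow> ereal" where
  "Lambda_circ U \<phi>1 \<phi>2 = Lim (at_right 0) (inf_near_diag U \<phi>1 \<phi>2)"

text \<open>\<^const>\<open>Lim\<close> is a definite description; the limit always exists, by monotonicity.\<close>

lemma inf_near_diag_tendsto:
  "(inf_near_diag U \<phi>1 \<phi>2 \<longlongrightarrow> Lambda_circ U \<phi>1 \<phi>2) (at_right 0)"
proof -
  let ?g = "inf_near_diag U \<phi>1 \<phi>2"
  let ?S = "SUP \<eta>\<in>{0<..}. ?g \<eta>"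
  have anti: "?g b \<le> ?g a" if "a \<le> b" for a b
    unfolding inf_near_diag_def using that by (intro INF_superset_mono) auto
  have "(?g \<longlongrightarrow> ?S) (at_right 0)"
  proof (rule order_tendstoI)
    fix a assume "a < ?S"
    then obtain b where b: "b > 0" "a < ?g b" by (auto simp: less_SUP_iff)
    have "a < ?g x" if "0 < x" "x < b" for x
      using b(2) anti[of x b] that by (simp add: order.strict_trans2)
    then show "\<forall>\<^sub>F x in at_right 0. a < ?g x"
      unfolding eventually_at_right_field using b(1) by auto
  next
    fix a assume a: "?S < a"
    have "?g x < a" if "0 < x" for x
    proof -
      have "?g x \<le> ?S" using that by (intro SUP_upper) auto
      then show ?thesis using a by simp
    qed
    then show "\<forall>\<^sub>F x in at_right 0. ?g x < a"
      unfolding eventually_at_right_field using zero_less_one by blast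
  qed
  then show ?thesis
    unfolding Lambda_circ_def by (metis tendsto_Lim trivial_limit_at_right_real)
qed

definition Lambda_dagger ::
  "'a::metric_space set \<Rightarrow> ('a \<Rightarrow> ereal) \<Rightarrow> ('a \<Rightarrow> ereal) \<Rightarrow> ereal" where
  "Lambda_dagger U \<phi>1 \<phi>2 = (INF V \<in> EI U. Lambda_circ V \<phi>1 \<phi>2)"

definition quasiuniformly_lsc_on ::
  "'a::metric_space set \<Rightarrow> ('a \<Rightarrow> ereal) \<Rightarrow> ('a \<Rightarrow> ereal) \<Rightarrow> bool" where
  "quasiuniformly_lsc_on U \<phi>1 \<phi>2 \<longleftrightarrow>
     (INF x\<in>U. \<phi>1 x + \<phi>2 x) \<le> Lambda_dagger U \<phi>1 \<phi>2"

definition quasiuniformly_lsc_near ::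
  "'a::metric_space \<Rightarrow> ('a \<Rightarrow> ereal) \<Rightarrow> ('a \<Rightarrow> ereal) \<Rightarrow> bool" where
  "quasiuniformly_lsc_near x \<phi>1 \<phi>2 \<longleftrightarrow>
     (\<exists>\<delta>0>0. \<forall>\<delta>. 0 < \<delta> \<and> \<delta> < \<delta>0 \<longrightarrow> quasiuniformly_lsc_on (cball x \<delta>) \<phi>1 \<phi>2)"

text \<open>
  The notions below are meant for a reference point \<open>x\<close> at which the function
  (respectively both functions) is finite.
\<close>

definition local_minimum :: "('a::metric_space \<Rightarrow> ereal) \<Rightarrow> 'a \<Rightarrow> bool" where
  "local_minimum f x \<longleftrightarrow> (\<exists>\<delta>>0. \<forall>u\<in>ball x \<delta>. f x \<le> f u)"

definition eps_minimum_on ::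
  "'a::metric_space set \<Rightarrow> real \<Rightarrow> ('a \<Rightarrow> ereal) \<Rightarrow> 'a \<Rightarrow> bool" where
  "eps_minimum_on U \<epsilon> f x \<longleftrightarrow> x \<in> U \<and> (INF u\<in>U. f u) > f x - ereal \<epsilon>"

text \<open>At an isolated point the lower limit is $+\infty$, so such a point is stationary.\<close>

definition stationary_point :: "('a::metric_space \<Rightarrow> ereal) \<Rightarrow> 'a \<Rightarrow> bool" where
  "stationary_point f x \<longleftrightarrow>
     Liminf (at x) (\<lambda>u. (f u - f x) / ereal (dist u x)) \<ge> 0"

definition local_quasiuniform_minimum ::
  "('a::metric_space \<Rightarrow> ereal) \<Rightarrow> ('a \<Rightarrow> ereal) \<Rightarrow> 'a \<Rightarrow> bool" where
  "local_quasiuniform_minimum \<phi>1 \<phi>2 x \<longleftrightarrow>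
     (\<exists>\<delta>>0. \<phi>1 x + \<phi>2 x = Lambda_dagger (ball x \<delta>) \<phi>1 \<phi>2)"

definition quasiuniform_eps_minimum ::
  "real \<Rightarrow> real \<Rightarrow> ('a::metric_space \<Rightarrow> ereal) \<Rightarrow> ('a \<Rightarrow> ereal) \<Rightarrow> 'a \<Rightarrow> bool" where
  "quasiuniform_eps_minimum \<epsilon> \<delta> \<phi>1 \<phi>2 x \<longleftrightarrow>
     \<phi>1 x + \<phi>2 x < Lambda_dagger (ball x \<delta>) \<phi>1 \<phi>2 + ereal \<epsilon>"

definition quasiuniform_stationary_point ::
  "('a::metric_space \<Rightarrow> ereal) \<Rightarrow> ('a \<Rightarrow> ereal) \<Rightarrow> 'a \<Rightarrow> bool" where
  "quasiuniform_stationary_point \<phi>1 \<phi>2 x \<longleftrightarrow>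
     (\<forall>\<epsilon>>0. \<exists>\<delta>\<^sub>\<epsilon>>0. \<forall>\<delta>. 0 < \<delta> \<and> \<delta> < \<delta>\<^sub>\<epsilon> \<longrightarrow>
        quasiuniform_eps_minimum (\<epsilon> * \<delta>) \<delta> \<phi>1 \<phi>2 x)"

end

theory Submission
  imports Defs
begin

text \<open>
  Write \<open>f = \<phi>1 + \<phi>2\<close>. Everything rests on comparing $\Lambda^\dagger$ on a ball with the
  infimum of \<open>f\<close>. A singleton inside an open set \<open>U\<close> is essentially interior to \<open>U\<close>, and
  on a singleton the decoupled infimum $\Lambda^\circ$ is just the value of \<open>f\<close>; hence
  $\Lambda^\dagger_U \le \inf_U f$ (\<open>Lambda_dagger_le_INF\<close>). So each quasiuniform property
  bounds \<open>f\<close> from below on a ball, which yields the corresponding ordinary property.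

  Quasiuniform lower semicontinuity is the opposite inequality $\inf_U f \le \Lambda^\dagger_U$.
  For \<open>\<epsilon>\<close>-minima it is assumed on the open ball itself. For local minima and stationary
  points it is only assumed on closed balls, but $\Lambda^\dagger$ decreases when the set
  grows, so a lower bound of \<open>f\<close> on a closed ball is, under this assumption, still a lower
  bound of $\Lambda^\dagger$ on the open ball of the same radius
  (\<open>lower_bound_le_Lambda_dagger_ball\<close>).

  Stationarity says that for every \<open>\<epsilon> > 0\<close> one has
  \<open>f u \<ge> f x - \<epsilon> * dist x u\<close> near \<open>x\<close> (\<open>stationary_point_iff_linear_minorant\<close>), whereas
  quasiuniform stationarity gives a bound \<open>f u \<ge> f x - \<epsilon> * \<delta>\<close> on \<open>ball x \<delta>\<close> which is
  uniform in \<open>u\<close>. In one direction the two are matched by taking \<open>\<delta>\<close> to be twice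
  \<open>dist x u\<close>; in the other the distance is bounded by \<open>\<delta>\<close>, and \<open>\<epsilon>\<close> is halved because the
  defining inequality of an \<open>\<epsilon>\<close>-minimum is strict.
\<close>

section \<open>Comparing the decoupled infimum with the infimum of the sum\<close>

lemma Lambda_circ_singleton: "Lambda_circ {u} \<phi>1 \<phi>2 = \<phi>1 u + \<phi>2 u"
proof -
  have "inf_near_diag {u} \<phi>1 \<phi>2 \<eta> = \<phi>1 u + \<phi>2 u" if "\<eta> > 0" for \<eta>
  proof -
    have "{(x1, x2). x1 \<in> {u} \<and> x2 \<in> {u} \<and> dist x1 x2 < \<eta>} = {(u, u)}"
      using that by auto
    then show ?thesis unfolding inf_near_diag_def by simp
  qed
  then have "\<forall>\<^sub>F \<eta> in at_right 0. inf_near_diag {u} \<phi>1 \<phi>2 \<eta> = \<phi>1 u + \<phi>2 u"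
    by (auto simp: eventually_at_right_field intro: exI[of _ 1])
  then have "(inf_near_diag {u} \<phi>1 \<phi>2 \<longlongrightarrow> \<phi>1 u + \<phi>2 u) (at_right 0)"
    by (rule tendsto_eventually)
  with inf_near_diag_tendsto show ?thesis
    by (rule tendsto_unique[OF trivial_limit_at_right_real])
qed

lemma Lambda_dagger_le_INF:
  assumes "open U"
  shows "Lambda_dagger U \<phi>1 \<phi>2 \<le> (INF u\<in>U. \<phi>1 u + \<phi>2 u)"
proof (rule INF_greatest)
  fix u assume u: "u \<in> U"
  then obtain \<rho> where "\<rho> > 0" "ball u \<rho> \<subseteq> U"
    using assms open_contains_ball by blast
  with u have "{u} \<in> EI U" unfolding EI_def by auto
  then have "Lambda_dagger U \<phi>1 \<phi>2 \<le> Lambda_circ {u} \<phi>1 \<phi>2"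
    unfolding Lambda_dagger_def by (rule INF_lower)
  then show "Lambda_dagger U \<phi>1 \<phi>2 \<le> \<phi>1 u + \<phi>2 u"
    by (simp add: Lambda_circ_singleton)
qed

lemma Lambda_dagger_antimono:
  assumes "U \<subseteq> W"
  shows "Lambda_dagger W \<phi>1 \<phi>2 \<le> Lambda_dagger U \<phi>1 \<phi>2"
proof -
  have "EI U \<subseteq> EI W" using assms unfolding EI_def by blast
  then show ?thesis unfolding Lambda_dagger_def by (intro INF_superset_mono) auto
qed

text \<open>
  This transfers semicontinuity from closed balls, where it is assumed, to open balls, where
  the quasiuniform notions of minimality live.
\<close>

lemma lower_bound_le_Lambda_dagger_ball:
  assumes "quasiuniformly_lsc_on (cball x \<delta>) \<phi>1 \<phi>2"
    and "\<And>u. u \<in> cball x \<delta> \<Longrightarrow> m \<le> \<phi>1 u + \<phi>2 u"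
  shows "m \<le> Lambda_dagger (ball x \<delta>) \<phi>1 \<phi>2"
proof -
  have "m \<le> (INF u\<in>cball x \<delta>. \<phi>1 u + \<phi>2 u)"
    using assms(2) by (rule INF_greatest)
  also have "\<dots> \<le> Lambda_dagger (cball x \<delta>) \<phi>1 \<phi>2"
    using assms(1) unfolding quasiuniformly_lsc_on_def .
  also have "\<dots> \<le> Lambda_dagger (ball x \<delta>) \<phi>1 \<phi>2"
    by (rule Lambda_dagger_antimono[OF ball_subset_cball])
  finally show ?thesis .
qed

section \<open>Local minima\<close>

lemma local_quasiuniform_minimum_imp_local_minimum:
  assumes "local_quasiuniform_minimum \<phi>1 \<phi>2 x"
  shows "local_minimum (\<lambda>u. \<phi>1 u + \<phi>2 u) x"
proof -
  obtain \<delta> where "\<delta> > 0" and eq: "\<phi>1 x + \<phi>2 x = Lambda_dagger (ball x \<delta>) \<phi>1 \<phi>2"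
    using assms unfolding local_quasiuniform_minimum_def by blast
  have "\<phi>1 x + \<phi>2 x \<le> (INF u\<in>ball x \<delta>. \<phi>1 u + \<phi>2 u)"
    unfolding eq by (rule Lambda_dagger_le_INF[OF open_ball])
  then show ?thesis
    using \<open>\<delta> > 0\<close> unfolding local_minimum_def le_INF_iff by blast
qed

lemma local_minimum_imp_local_quasiuniform_minimum:
  assumes "quasiuniformly_lsc_near x \<phi>1 \<phi>2"
    and "local_minimum (\<lambda>u. \<phi>1 u + \<phi>2 u) x"
  shows "local_quasiuniform_minimum \<phi>1 \<phi>2 x"
proof -
  obtain \<delta>0 where \<delta>0: "\<delta>0 > 0"
    "\<And>\<delta>. 0 < \<delta> \<Longrightarrow> \<delta> < \<delta>0 \<Longrightarrow> quasiuniformly_lsc_on (cball x \<delta>) \<phi>1 \<phi>2"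
    using assms(1) unfolding quasiuniformly_lsc_near_def by blast
  obtain \<delta>1 where \<delta>1: "\<delta>1 > 0" "\<And>u. u \<in> ball x \<delta>1 \<Longrightarrow> \<phi>1 x + \<phi>2 x \<le> \<phi>1 u + \<phi>2 u"
    using assms(2) unfolding local_minimum_def by blast
  define \<delta> where "\<delta> = min \<delta>0 \<delta>1 / 2"
  have \<delta>: "0 < \<delta>" "\<delta> < \<delta>0" "\<delta> < \<delta>1" using \<delta>0(1) \<delta>1(1) by (auto simp: \<delta>_def)
  have "\<phi>1 x + \<phi>2 x \<le> Lambda_dagger (ball x \<delta>) \<phi>1 \<phi>2"
    using \<delta>0(2)[OF \<delta>(1,2)] \<delta>1(2) \<delta>(3)
    by (intro lower_bound_le_Lambda_dagger_ball) auto
  moreover have "Lambda_dagger (ball x \<delta>) \<phi>1 \<phi>2 \<le> \<phi>1 x + \<phi>2 x"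
    using Lambda_dagger_le_INF[OF open_ball, of x \<delta> \<phi>1 \<phi>2] \<delta>(1)
    by (simp add: le_INF_iff)
  ultimately show ?thesis
    unfolding local_quasiuniform_minimum_def using \<delta>(1) by (intro exI[of _ \<delta>]) auto
qed

section \<open>\<open>\<epsilon>\<close>-minima\<close>

lemma ereal_less_add_iff_diff_less:
  "ereal c < (a :: ereal) + ereal e \<longleftrightarrow> ereal c - ereal e < a"
  by (cases a) auto

lemma quasiuniform_eps_minimum_imp_eps_minimum_on:
  assumes "\<phi>1 x + \<phi>2 x = ereal c" and "\<delta> > 0"
    and "quasiuniform_eps_minimum \<epsilon> \<delta> \<phi>1 \<phi>2 x"
  shows "eps_minimum_on (ball x \<delta>) \<epsilon> (\<lambda>u. \<phi>1 u + \<phi>2 u) x"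
proof -
  have "ereal c - ereal \<epsilon> < Lambda_dagger (ball x \<delta>) \<phi>1 \<phi>2"
    using assms(1,3)
    by (simp add: quasiuniform_eps_minimum_def ereal_less_add_iff_diff_less)
  also have "\<dots> \<le> (INF u\<in>ball x \<delta>. \<phi>1 u + \<phi>2 u)"
    by (rule Lambda_dagger_le_INF[OF open_ball])
  finally show ?thesis using assms(1,2) by (simp add: eps_minimum_on_def)
qed

lemma eps_minimum_on_imp_quasiuniform_eps_minimum:
  assumes "\<phi>1 x + \<phi>2 x = ereal c"
    and "quasiuniformly_lsc_on (ball x \<delta>) \<phi>1 \<phi>2"
    and "eps_minimum_on (ball x \<delta>) \<epsilon> (\<lambda>u. \<phi>1 u + \<phi>2 u) x"
  shows "quasiuniform_eps_minimum \<epsilon> \<delta> \<phi>1 \<phi>2 x"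
proof -
  have "ereal c - ereal \<epsilon> < (INF u\<in>ball x \<delta>. \<phi>1 u + \<phi>2 u)"
    using assms(1,3) by (simp add: eps_minimum_on_def)
  also have "\<dots> \<le> Lambda_dagger (ball x \<delta>) \<phi>1 \<phi>2"
    using assms(2) unfolding quasiuniformly_lsc_on_def .
  finally show ?thesis
    using assms(1) by (simp add: quasiuniform_eps_minimum_def ereal_less_add_iff_diff_less)
qed

section \<open>Stationary points\<close>

lemma ereal_less_divide_pos_iff:
  assumes "d > 0"
  shows "ereal (- \<epsilon>) < (a - ereal c) / ereal d \<longleftrightarrow> ereal (c - \<epsilon> * d) < a"
  using assms by (cases a) (auto simp: field_simps)

text \<open>
  Clearing denominators removes the difference quotient and the exclusion of \<open>x\<close> itself. The
  strict inequality supplied by the lower limit is weakened so that the bound also holds at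
  \<open>u = x\<close>; conversely, halving \<open>\<epsilon>\<close> restores strictness.
\<close>

lemma stationary_point_iff_linear_minorant:
  assumes fx: "f x = ereal c"
  shows "stationary_point f x \<longleftrightarrow>
    (\<forall>\<epsilon>>0. \<exists>\<delta>>0. \<forall>u\<in>ball x \<delta>. ereal (c - \<epsilon> * dist x u) \<le> f u)"
proof
  assume "stationary_point f x"
  then have ev: "\<forall>\<^sub>F u in at x. y < (f u - f x) / ereal (dist u x)" if "y < 0" for y
    using that unfolding stationary_point_def le_Liminf_iff by blast
  show "\<forall>\<epsilon>>0. \<exists>\<delta>>0. \<forall>u\<in>ball x \<delta>. ereal (c - \<epsilon> * dist x u) \<le> f u"
  proof (intro allI impI)
    fix \<epsilon> :: real assume "\<epsilon> > 0"
    then have "\<forall>\<^sub>F u in at x. ereal (- \<epsilon>) < (f u - f x) / ereal (dist u x)"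
      by (intro ev) auto
    then obtain \<delta> where "\<delta> > 0" and
      \<delta>: "\<And>u. u \<noteq> x \<Longrightarrow> dist u x < \<delta> \<Longrightarrow> ereal (- \<epsilon>) < (f u - ereal c) / ereal (dist u x)"
      unfolding eventually_at fx by auto
    have "ereal (c - \<epsilon> * dist x u) \<le> f u" if "u \<in> ball x \<delta>" for u
    proof (cases "u = x")
      case False
      then have "ereal (c - \<epsilon> * dist u x) < f u"
        using \<delta>[of u] that ereal_less_divide_pos_iff[of "dist u x" \<epsilon> "f u" c]
        by (simp add: dist_commute)
      then show ?thesis by (simp add: dist_commute)
    qed (simp add: fx)
    with \<open>\<delta> > 0\<close> show "\<exists>\<delta>>0. \<forall>u\<in>ball x \<delta>. ereal (c - \<epsilon> * dist x u) \<le> f u" by blast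
  qed
next
  assume minorant: "\<forall>\<epsilon>>0. \<exists>\<delta>>0. \<forall>u\<in>ball x \<delta>. ereal (c - \<epsilon> * dist x u) \<le> f u"
  show "stationary_point f x"
    unfolding stationary_point_def le_Liminf_iff
  proof (intro allI impI)
    fix y :: ereal assume "y < 0"
    then obtain r where r: "y < ereal r" "ereal r < 0" using ereal_dense2 by blast
    define \<epsilon> where "\<epsilon> = - r"
    have "\<epsilon> > 0" and y: "y < ereal (- \<epsilon>)" using r by (auto simp: \<epsilon>_def)
    obtain \<delta> where "\<delta> > 0" and
      \<delta>: "\<And>u. u \<in> ball x \<delta> \<Longrightarrow> ereal (c - \<epsilon> / 2 * dist x u) \<le> f u"
      using minorant[rule_format, OF half_gt_zero[OF \<open>\<epsilon> > 0\<close>]] by blast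
    have "y < (f u - f x) / ereal (dist u x)" if "u \<noteq> x" "dist u x < \<delta>" for u
    proof -
      have "ereal (c - \<epsilon> * dist u x) < ereal (c - \<epsilon> / 2 * dist u x)"
        using \<open>\<epsilon> > 0\<close> that(1) by simp
      also have "\<dots> \<le> f u" using \<delta>[of u] that(2) by (simp add: dist_commute)
      finally have "ereal (- \<epsilon>) < (f u - ereal c) / ereal (dist u x)"
        using that(1) by (subst ereal_less_divide_pos_iff) auto
      with y show ?thesis unfolding fx by (rule less_trans)
    qed
    with \<open>\<delta> > 0\<close> show "\<forall>\<^sub>F u in at x. y < (f u - f x) / ereal (dist u x)"
      unfolding eventually_at by auto
  qed
qed

lemma quasiuniform_stationary_point_imp_stationary_point:
  assumes fx: "\<phi>1 x + \<phi>2 x = ereal c"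
    and "quasiuniform_stationary_point \<phi>1 \<phi>2 x"
  shows "stationary_point (\<lambda>u. \<phi>1 u + \<phi>2 u) x"
  unfolding stationary_point_iff_linear_minorant[where f = "\<lambda>u. \<phi>1 u + \<phi>2 u", OF fx]
proof (intro allI impI)
  fix \<epsilon> :: real assume "\<epsilon> > 0"
  obtain \<delta>0 where "\<delta>0 > 0" and
    \<delta>0: "\<And>\<delta>. 0 < \<delta> \<Longrightarrow> \<delta> < \<delta>0 \<Longrightarrow> quasiuniform_eps_minimum (\<epsilon> / 2 * \<delta>) \<delta> \<phi>1 \<phi>2 x"
    using assms(2)[unfolded quasiuniform_stationary_point_def, rule_format,
        OF half_gt_zero[OF \<open>\<epsilon> > 0\<close>]]
    by blast
  have "ereal (c - \<epsilon> * dist x u) \<le> \<phi>1 u + \<phi>2 u" if u: "u \<in> ball x (\<delta>0 / 2)" for u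
  proof (cases "u = x")
    case False
    (* The radius must exceed the distance, so that the open ball contains u. *)
    define \<delta> where "\<delta> = 2 * dist x u"
    have \<delta>: "0 < \<delta>" "\<delta> < \<delta>0" "u \<in> ball x \<delta>" using False u by (auto simp: \<delta>_def)
    have "ereal c - ereal (\<epsilon> / 2 * \<delta>) < (INF u\<in>ball x \<delta>. \<phi>1 u + \<phi>2 u)"
      using quasiuniform_eps_minimum_imp_eps_minimum_on[OF fx \<delta>(1) \<delta>0[OF \<delta>(1,2)]]
      by (simp add: eps_minimum_on_def fx)
    also have "\<dots> \<le> \<phi>1 u + \<phi>2 u" using \<delta>(3) by (rule INF_lower)
    finally show ?thesis by (simp add: \<delta>_def)
  qed (simp add: fx)
  with \<open>\<delta>0 > 0\<close> show
    "\<exists>\<delta>>0. \<forall>u\<in>ball x \<delta>. ereal (c - \<epsilon> * dist x u) \<le> \<phi>1 u + \<phi>2 u"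
    by (intro exI[of _ "\<delta>0 / 2"]) auto
qed

lemma stationary_point_imp_quasiuniform_stationary_point:
  assumes fx: "\<phi>1 x + \<phi>2 x = ereal c"
    and "quasiuniformly_lsc_near x \<phi>1 \<phi>2"
    and "stationary_point (\<lambda>u. \<phi>1 u + \<phi>2 u) x"
  shows "quasiuniform_stationary_point \<phi>1 \<phi>2 x"
  unfolding quasiuniform_stationary_point_def
proof (intro allI impI)
  fix \<epsilon> :: real assume "\<epsilon> > 0"
  obtain \<delta>0 where "\<delta>0 > 0" and
    \<delta>0: "\<And>\<delta>. 0 < \<delta> \<Longrightarrow> \<delta> < \<delta>0 \<Longrightarrow> quasiuniformly_lsc_on (cball x \<delta>) \<phi>1 \<phi>2"
    using assms(2) unfolding quasiuniformly_lsc_near_def by blast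
  obtain \<delta>1 where "\<delta>1 > 0" and
    \<delta>1: "\<And>u. u \<in> ball x \<delta>1 \<Longrightarrow> ereal (c - \<epsilon> / 2 * dist x u) \<le> \<phi>1 u + \<phi>2 u"
    using assms(3)[unfolded stationary_point_iff_linear_minorant[where
            f = "\<lambda>u. \<phi>1 u + \<phi>2 u", OF fx], rule_format, OF half_gt_zero[OF \<open>\<epsilon> > 0\<close>]]
    by blast
  have "quasiuniform_eps_minimum (\<epsilon> * \<delta>) \<delta> \<phi>1 \<phi>2 x"
    if \<delta>: "0 < \<delta>" "\<delta> < min \<delta>0 \<delta>1" for \<delta>
  proof -
    have "ereal (c - \<epsilon> / 2 * \<delta>) \<le> \<phi>1 u + \<phi>2 u" if "u \<in> cball x \<delta>" for u
    proof -
      have "ereal (c - \<epsilon> / 2 * \<delta>) \<le> ereal (c - \<epsilon> / 2 * dist x u)"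
        using \<open>\<epsilon> > 0\<close> that by (simp add: mult_left_mono)
      also have "\<dots> \<le> \<phi>1 u + \<phi>2 u" using that \<delta>(2) by (intro \<delta>1) auto
      finally show ?thesis .
    qed
    then have "ereal (c - \<epsilon> / 2 * \<delta>) \<le> Lambda_dagger (ball x \<delta>) \<phi>1 \<phi>2"
      using \<delta>0 \<delta> by (intro lower_bound_le_Lambda_dagger_ball) auto
    moreover have "ereal c - ereal (\<epsilon> * \<delta>) < ereal (c - \<epsilon> / 2 * \<delta>)"
      using \<open>\<epsilon> > 0\<close> \<delta>(1) by simp
    ultimately show ?thesis
      unfolding quasiuniform_eps_minimum_def fx ereal_less_add_iff_diff_less
      by (rule order.strict_trans2[rotated])
  qed
  with \<open>\<delta>0 > 0\<close> \<open>\<delta>1 > 0\<close> show "\<exists>\<delta>\<^sub>\<epsilon>>0. \<forall>\<delta>. 0 < \<delta> \<and> \<delta> < \<delta>\<^sub>\<epsilon> \<longrightarrow>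
      quasiuniform_eps_minimum (\<epsilon> * \<delta>) \<delta> \<phi>1 \<phi>2 x"
    by (intro exI[of _ "min \<delta>0 \<delta>1"]) auto
qed

section \<open>Quasiuniform and ordinary minimality\<close>

theorem proposition6p4:
  fixes \<phi>1 \<phi>2 :: "'a::metric_space \<Rightarrow> ereal" and xbar :: 'a
  assumes "Rinf_valued \<phi>1" and "Rinf_valued \<phi>2"
    and "xbar \<in> edom \<phi>1 \<inter> edom \<phi>2"
  shows
    "((local_quasiuniform_minimum \<phi>1 \<phi>2 xbar \<longrightarrow>
         local_minimum (\<lambda>x. \<phi>1 x + \<phi>2 x) xbar) \<and>
      (quasiuniformly_lsc_near xbar \<phi>1 \<phi>2 \<longrightarrow>
         (local_quasiuniform_minimum \<phi>1 \<phi>2 xbar \<longleftrightarrow>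
          local_minimum (\<lambda>x. \<phi>1 x + \<phi>2 x) xbar))) \<and>
     (\<forall>\<epsilon>>0. \<forall>\<delta>>0.
      (quasiuniform_eps_minimum \<epsilon> \<delta> \<phi>1 \<phi>2 xbar \<longrightarrow>
         eps_minimum_on (ball xbar \<delta>) \<epsilon> (\<lambda>x. \<phi>1 x + \<phi>2 x) xbar) \<and>
      (quasiuniformly_lsc_on (ball xbar \<delta>) \<phi>1 \<phi>2 \<longrightarrow>
         (quasiuniform_eps_minimum \<epsilon> \<delta> \<phi>1 \<phi>2 xbar \<longleftrightarrow>
          eps_minimum_on (ball xbar \<delta>) \<epsilon> (\<lambda>x. \<phi>1 x + \<phi>2 x) xbar))) \<and>
     ((quasiuniform_stationary_point \<phi>1 \<phi>2 xbar \<longrightarrow>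
         stationary_point (\<lambda>x. \<phi>1 x + \<phi>2 x) xbar) \<and>
      (quasiuniformly_lsc_near xbar \<phi>1 \<phi>2 \<longrightarrow>
         (quasiuniform_stationary_point \<phi>1 \<phi>2 xbar \<longleftrightarrow>
          stationary_point (\<lambda>x. \<phi>1 x + \<phi>2 x) xbar)))"
proof -
  obtain c where finite: "\<phi>1 xbar + \<phi>2 xbar = ereal c"
    using assms unfolding Rinf_valued_def edom_def
    by (cases "\<phi>1 xbar"; cases "\<phi>2 xbar") auto
  note implications =
    local_quasiuniform_minimum_imp_local_minimum
    local_minimum_imp_local_quasiuniform_minimum
    quasiuniform_eps_minimum_imp_eps_minimum_on
    eps_minimum_on_imp_quasiuniform_eps_minimum
    quasiuniform_stationary_point_imp_stationary_point
    stationary_point_imp_quasiuniform_stationary_point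
  show ?thesis
    by (intro conjI allI impI iffI; rule implications; (assumption | rule finite))
qed

end
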